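(* Let $p,q>3$ be primes such that $(p,q)_3$ is an elliptic pair over $3$ with a representative curve of $j$-invariant $0$. Write $p=a^2+3b^2$ with integers $a,b$, $a\equiv -1\pmod 3$, and choose the sign of $b$ such that $q=p+1+a-3b$. Then $A_{pq}=a+b$.
   Context: For a positive square-free integer $d$, an ordered pair $(p,q)$ of primes $p,q>3$ (possibly $p=q$) is an elliptic pair over $d$, written $(p,q)_d$, if there exists an elliptic curve $E$ with complex multiplication in $\mathbb{Q}(\sqrt{-d})$ (i.e. by an order of this field) having order $q$ when examined over $\mathbb{F}_p$; such an $E$ is called a representative curve. Here $E$ is a curve in characteristic zero, defined over a number field, with good reduction at a prime with residue field $\mathbb{F}_p$, and the reduced curve has exactly $q$ points over $\mathbb{F}_p$, counting the point at infinity. For an elliptic pair $(p,q)_3$, $A_{pq}$ denotes the integer with $A_{pq}^2=\frac{2pq+2p+2q-p^2-q^2-1}{3}$ whose sign is chosen so that $A_{pq}\equiv p+q+1\pmod 4$. *)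

theory Defs
  imports
    "HOL-Algebra.Algebraic_Closure_Type"
    "HOL-Number_Theory.Number_Theory"
begin

hide_const (open) Divisibility.prime

section \<open>Number fields\<close>

text \<open>Number fields are taken as subfields of the complex numbers; every abstract number field
  embeds there.\<close>

abbreviation complex_ring :: "complex ring" where
  "complex_ring \<equiv> ring_of_type_algebra"

definition number_field :: "complex set \<Rightarrow> bool" where
  "number_field K \<longleftrightarrow> subfield K complex_ring \<and> ring.finite_dimension complex_ring \<rat> K"

definition ring_of_integers :: "complex set \<Rightarrow> complex set" where
  "ring_of_integers K = {x \<in> K. algebraic_int x}"

definition prime_of :: "complex set \<Rightarrow> complex set \<Rightarrow> bool" where
  "prime_of K P \<longleftrightarrow> primeideal P (complex_ring\<lparr>carrier := ring_of_integers K\<rparr>) \<and> P \<noteq> {0}"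

definition local_ring :: "complex set \<Rightarrow> complex set \<Rightarrow> complex set" where
  "local_ring K P = {x / y | x y. x \<in> ring_of_integers K \<and> y \<in> ring_of_integers K - P}"

definition local_maximal :: "complex set \<Rightarrow> complex set \<Rightarrow> complex set" where
  "local_maximal K P = {x / y | x y. x \<in> P \<and> y \<in> ring_of_integers K - P}"

definition residue_field :: "complex set \<Rightarrow> complex set \<Rightarrow> complex set ring" where
  "residue_field K P = complex_ring\<lparr>carrier := local_ring K P\<rparr> Quot local_maximal K P"

definition residue_class :: "complex set \<Rightarrow> complex set \<Rightarrow> complex \<Rightarrow> complex set" where
  "residue_class K P x =
     local_maximal K P +>\<^bsub>complex_ring\<lparr>carrier := local_ring K P\<rparr>\<^esub> x"

definition imag_quadratic_field :: "nat \<Rightarrow> complex set" where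
  "imag_quadratic_field d = {of_rat x + of_rat y * csqrt (- of_nat d) | x y. True}"

text \<open>An order of \<open>F\<close> is a subring that is finitely generated as an abelian group and spans \<open>F\<close>
  over the rationals; the last conjunct expresses the spanning, by clearing denominators.\<close>

definition is_order :: "complex set \<Rightarrow> complex set \<Rightarrow> bool" where
  "is_order R F \<longleftrightarrow> subring R complex_ring \<and> R \<subseteq> F \<and>
     (\<exists>B. finite B \<and> R = {\<Sum>b\<in>B. of_int (c b) * b | c :: complex \<Rightarrow> int. True}) \<and>
     (\<forall>x\<in>F. \<exists>n::int. n \<noteq> 0 \<and> of_int n * x \<in> R)"

section \<open>Weierstrass curves\<close>

text \<open>The curve \<open>y\<^sup>2 + a\<^sub>1 x y + a\<^sub>3 y = x\<^sup>3 + a\<^sub>2 x\<^sup>2 + a\<^sub>4 x + a\<^sub>6\<close>.\<close>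

datatype 'a weierstrass =
  Weierstrass (wa1: 'a) (wa2: 'a) (wa3: 'a) (wa4: 'a) (wa6: 'a)

definition b2 :: "'a::comm_ring_1 weierstrass \<Rightarrow> 'a" where
  "b2 W = (wa1 W)\<^sup>2 + 4 * wa2 W"

definition b4 :: "'a::comm_ring_1 weierstrass \<Rightarrow> 'a" where
  "b4 W = 2 * wa4 W + wa1 W * wa3 W"

definition b6 :: "'a::comm_ring_1 weierstrass \<Rightarrow> 'a" where
  "b6 W = (wa3 W)\<^sup>2 + 4 * wa6 W"

definition b8 :: "'a::comm_ring_1 weierstrass \<Rightarrow> 'a" where
  "b8 W = (wa1 W)\<^sup>2 * wa6 W + 4 * wa2 W * wa6 W - wa1 W * wa3 W * wa4 W
          + wa2 W * (wa3 W)\<^sup>2 - (wa4 W)\<^sup>2"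

definition discriminant :: "'a::comm_ring_1 weierstrass \<Rightarrow> 'a" where
  "discriminant W = - (b2 W)\<^sup>2 * b8 W - 8 * b4 W ^ 3 - 27 * (b6 W)\<^sup>2 + 9 * b2 W * b4 W * b6 W"

definition j_invariant :: "'a::field weierstrass \<Rightarrow> 'a" where
  "j_invariant W = ((b2 W)\<^sup>2 - 24 * b4 W) ^ 3 / discriminant W"

definition elliptic_curve_over :: "complex set \<Rightarrow> complex weierstrass \<Rightarrow> bool" where
  "elliptic_curve_over K W \<longleftrightarrow> set_weierstrass W \<subseteq> K \<and> discriminant W \<noteq> 0"

text \<open>\<open>W'\<close> arises from \<open>W\<close> by the substitution \<open>x = u\<^sup>2 x' + r\<close>, \<open>y = u\<^sup>3 y' + s u\<^sup>2 x' + t\<close>.\<close>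

definition weierstrass_iso :: "complex set \<Rightarrow> complex weierstrass \<Rightarrow> complex weierstrass \<Rightarrow> bool" where
  "weierstrass_iso K W W' \<longleftrightarrow> (\<exists>u\<in>K. \<exists>r\<in>K. \<exists>s\<in>K. \<exists>t\<in>K. u \<noteq> 0 \<and>
     u * wa1 W' = wa1 W + 2 * s \<and>
     u ^ 2 * wa2 W' = wa2 W - s * wa1 W + 3 * r - s ^ 2 \<and>
     u ^ 3 * wa3 W' = wa3 W + r * wa1 W + 2 * t \<and>
     u ^ 4 * wa4 W' = wa4 W - s * wa3 W + 2 * r * wa2 W - (t + r * s) * wa1 W
                      + 3 * r ^ 2 - 2 * s * t \<and>
     u ^ 6 * wa6 W' = wa6 W + r * wa4 W + r ^ 2 * wa2 W + r ^ 3 - t * wa3 W - t ^ 2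
                      - r * t * wa1 W)"

section \<open>Group law and endomorphisms\<close>

datatype 'a point = Infinity | Affine 'a 'a

fun on_curve :: "'a::field weierstrass \<Rightarrow> 'a point \<Rightarrow> bool" where
  "on_curve W Infinity \<longleftrightarrow> True"
| "on_curve W (Affine x y) \<longleftrightarrow>
     y ^ 2 + wa1 W * x * y + wa3 W * y = x ^ 3 + wa2 W * x ^ 2 + wa4 W * x + wa6 W"

definition curve_points :: "'a::field weierstrass \<Rightarrow> 'a point set" where
  "curve_points W = {P. on_curve W P}"

fun point_add :: "'a::field weierstrass \<Rightarrow> 'a point \<Rightarrow> 'a point \<Rightarrow> 'a point" where
  "point_add W Infinity Q = Q"
| "point_add W P Infinity = P"
| "point_add W (Affine x1 y1) (Affine x2 y2) =
     (if x1 = x2 \<and> y1 + y2 + wa1 W * x2 + wa3 W = 0 then Infinity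
      else let
        l = (if x1 \<noteq> x2 then (y2 - y1) / (x2 - x1)
             else (3 * x1 ^ 2 + 2 * wa2 W * x1 + wa4 W - wa1 W * y1) / (2 * y1 + wa1 W * x1 + wa3 W));
        x3 = l ^ 2 + wa1 W * l - wa2 W - x1 - x2;
        y3 = - (l + wa1 W) * x3 - (y1 - l * x1) - wa3 W
      in Affine x3 y3)"

fun projective_coords :: "'a::field point \<Rightarrow> 'a \<times> 'a \<times> 'a" where
  "projective_coords Infinity = (0, 1, 0)"
| "projective_coords (Affine x y) = (x, y, 1)"

text \<open>The value at \<open>P\<close> of the form \<open>\<Sum> c i j u\<^sup>i v\<^sup>j w\<^bsup>n-i-j\<^esup>\<close> of degree \<open>n\<close>.\<close>

definition form_eval :: "nat \<Rightarrow> (nat \<Rightarrow> nat \<Rightarrow> 'a) \<Rightarrow> 'a::field point \<Rightarrow> 'a" where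
  "form_eval n c P = (case projective_coords P of (u, v, w) \<Rightarrow>
     (\<Sum>i\<le>n. \<Sum>j\<le>n - i. c i j * u ^ i * v ^ j * w ^ (n - i - j)))"

text \<open>A morphism is given near every point \<open>P\<close> by three forms of equal degree without common zero
  at \<open>P\<close>; wherever these forms do not all vanish they are homogeneous coordinates of the image.
  The scalar \<open>k\<close> below is then automatically nonzero.\<close>

definition curve_morphism :: "'a::field weierstrass \<Rightarrow> ('a point \<Rightarrow> 'a point) \<Rightarrow> bool" where
  "curve_morphism W \<phi> \<longleftrightarrow> (\<forall>P\<in>curve_points W. \<exists>n c d e.
     (form_eval n c P, form_eval n d P, form_eval n e P) \<noteq> (0, 0, 0) \<and>
     (\<forall>Q\<in>curve_points W.
        (form_eval n c Q, form_eval n d Q, form_eval n e Q) \<noteq> (0, 0, 0) \<longrightarrow>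
        (case projective_coords (\<phi> Q) of (u, v, w) \<Rightarrow>
           \<exists>k. (form_eval n c Q, form_eval n d Q, form_eval n e Q) = (k * u, k * v, k * w))))"

text \<open>Endomorphisms are the morphisms fixing the point at infinity. They are extensional functions
  (undefined off the curve), so that equal endomorphisms are equal elements of the ring. For a curve
  over a number field in the complex numbers this is the geometric endomorphism ring.\<close>

definition endomorphism_ring :: "complex weierstrass \<Rightarrow> (complex point \<Rightarrow> complex point) ring" where
  "endomorphism_ring W =
     \<lparr>carrier = {\<phi> \<in> curve_points W \<rightarrow>\<^sub>E curve_points W. curve_morphism W \<phi> \<and> \<phi> Infinity = Infinity},
      monoid.mult = compose (curve_points W),
      one = (\<lambda>P\<in>curve_points W. P),
      ring.zero = (\<lambda>P\<in>curve_points W. Infinity),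
      add = (\<lambda>\<phi> \<psi>. \<lambda>P\<in>curve_points W. point_add W (\<phi> P) (\<psi> P))\<rparr>"

definition has_cm_in :: "nat \<Rightarrow> complex weierstrass \<Rightarrow> bool" where
  "has_cm_in d W \<longleftrightarrow> (\<exists>R. is_order R (imag_quadratic_field d) \<and>
     endomorphism_ring W \<simeq> complex_ring\<lparr>carrier := R\<rparr>)"

section \<open>Reduction\<close>

definition integral_model ::
    "complex set \<Rightarrow> complex set \<Rightarrow> complex weierstrass \<Rightarrow> complex weierstrass \<Rightarrow> bool" where
  "integral_model K P W W' \<longleftrightarrow> weierstrass_iso K W W' \<and> set_weierstrass W' \<subseteq> local_ring K P"

text \<open>Minimality of the valuation of the discriminant is phrased as divisibility in the local ring.\<close>

definition minimal_model ::
    "complex set \<Rightarrow> complex set \<Rightarrow> complex weierstrass \<Rightarrow> complex weierstrass \<Rightarrow> bool" where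
  "minimal_model K P W W' \<longleftrightarrow> integral_model K P W W' \<and>
     (\<forall>W''. integral_model K P W W'' \<longrightarrow> discriminant W'' / discriminant W' \<in> local_ring K P)"

definition reduction ::
    "complex set \<Rightarrow> complex set \<Rightarrow> complex weierstrass \<Rightarrow> complex set weierstrass" where
  "reduction K P = map_weierstrass (residue_class K P)"

definition affine_points :: "'a ring \<Rightarrow> 'a weierstrass \<Rightarrow> ('a \<times> 'a) set" where
  "affine_points F W = {(x, y). x \<in> carrier F \<and> y \<in> carrier F \<and>
     y \<otimes>\<^bsub>F\<^esub> y \<oplus>\<^bsub>F\<^esub> wa1 W \<otimes>\<^bsub>F\<^esub> x \<otimes>\<^bsub>F\<^esub> y \<oplus>\<^bsub>F\<^esub> wa3 W \<otimes>\<^bsub>F\<^esub> y =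
     x \<otimes>\<^bsub>F\<^esub> x \<otimes>\<^bsub>F\<^esub> x \<oplus>\<^bsub>F\<^esub> wa2 W \<otimes>\<^bsub>F\<^esub> x \<otimes>\<^bsub>F\<^esub> x \<oplus>\<^bsub>F\<^esub> wa4 W \<otimes>\<^bsub>F\<^esub> x \<oplus>\<^bsub>F\<^esub> wa6 W}"

text \<open>Good reduction at \<open>P\<close> (the discriminant of a minimal model is a unit at \<open>P\<close>, i.e. its
  reduction is nonsingular) with \<open>q\<close> points over the residue field, the summand 1 being the point
  at infinity.\<close>

definition good_reduction_of_order ::
    "complex set \<Rightarrow> complex set \<Rightarrow> complex weierstrass \<Rightarrow> nat \<Rightarrow> bool" where
  "good_reduction_of_order K P W q \<longleftrightarrow>
     (\<exists>W'. minimal_model K P W W' \<and> discriminant W' \<notin> local_maximal K P \<and>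
        card (affine_points (residue_field K P) (reduction K P W')) + 1 = q)"

section \<open>Elliptic pairs\<close>

definition representative_curve ::
    "nat \<Rightarrow> nat \<Rightarrow> nat \<Rightarrow> complex set \<Rightarrow> complex weierstrass \<Rightarrow> bool" where
  "representative_curve d p q K E \<longleftrightarrow>
     number_field K \<and> elliptic_curve_over K E \<and> has_cm_in d E \<and>
     (\<exists>P. prime_of K P \<and> residue_field K P \<simeq> residue_ring (int p) \<and>
        good_reduction_of_order K P E q)"

definition elliptic_pair :: "nat \<Rightarrow> nat \<Rightarrow> nat \<Rightarrow> bool" where
  "elliptic_pair d p q \<longleftrightarrow> d > 0 \<and> squarefree d \<and> prime p \<and> prime q \<and> p > 3 \<and> q > 3 \<and>
     (\<exists>K E. representative_curve d p q K E)"

definition A_pair :: "nat \<Rightarrow> nat \<Rightarrow> int" where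
  "A_pair p q = (THE A.
     (real_of_int A)\<^sup>2 =
       (2 * real p * real q + 2 * real p + 2 * real q - (real p)\<^sup>2 - (real q)\<^sup>2 - 1) / 3 \<and>
     [A = int p + int q + 1] (mod 4))"

end

(* The trace of Frobenius is t = p + 1 - q = 3 b - a, and the radicand of A_pq is
   (4 p - t^2) / 3 = (a + b)^2. As p and q are odd, p + q + 1 = 2 (p + 1) + a - 3 b is
   congruent to a + b modulo 4; being odd, it tells a + b from -(a + b). *)
theory Submission
  imports Defs
begin

theorem corollary2p10:
  fixes p q :: nat and a b :: int and K :: "complex set" and E :: "complex weierstrass"
  assumes "prime p" and "prime q" and "p > 3" and "q > 3"
    and "elliptic_pair 3 p q"
    and "representative_curve 3 p q K E" and "j_invariant E = 0"
    and "int p = a\<^sup>2 + 3 * b\<^sup>2" and "[a = -1] (mod 3)"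
    and "int q = int p + 1 + a - 3 * b"
  shows "A_pair p q = a + b"
proof -
  have odd: "odd (int p)" "odd (int q)"
    using assms(1-4) prime_odd_nat by auto
  have "real p = real_of_int (int p)" "real q = real_of_int (int q)"
    by simp_all
  then have p: "real p = (real_of_int a)\<^sup>2 + 3 * (real_of_int b)\<^sup>2"
    and q: "real q = real p + 1 + real_of_int a - 3 * real_of_int b"
    unfolding assms(8,10) by simp_all
  \<comment> \<open>The numerator is \<open>4p - (p + 1 - q)^2\<close>, and
    \<open>4(a^2 + 3b^2) - (3b - a)^2 = 3(a + b)^2\<close>.\<close>
  have radicand: "(2 * real p * real q + 2 * real p + 2 * real q - (real p)\<^sup>2 - (real q)\<^sup>2 - 1) / 3
      = (real_of_int (a + b))\<^sup>2"
    unfolding q p by (simp add: power2_eq_square algebra_simps)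
  \<comment> \<open>\<open>2(p + 1)\<close> vanishes modulo 4 since \<open>p\<close> is odd, and
    \<open>-3b\<close> is congruent to \<open>b\<close>.\<close>
  have cong: "[A = int p + int q + 1] (mod 4) \<longleftrightarrow> A mod 4 = (a + b) mod 4" for A
    using odd(1) unfolding cong_def assms(10) by presburger
  \<comment> \<open>Same parity as \<open>a - 3b = q - (p + 1)\<close>.\<close>
  have "odd (a + b)"
    using odd unfolding assms(10) by presburger
  show ?thesis
    \<comment> \<open>Both conditions now hold for \<open>a + b\<close> by reflexivity; uniqueness
      remains.\<close>
    unfolding A_pair_def radicand cong
  proof (rule the_equality, intro conjI refl, elim conjE)
    fix A :: int
    assume "(real_of_int A)\<^sup>2 = (real_of_int (a + b))\<^sup>2" and A: "A mod 4 = (a + b) mod 4"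
    then have "A = a + b \<or> A = - (a + b)"
      by (metis of_int_eq_iff of_int_power power2_eq_iff)
    \<comment> \<open>\<open>A = -(a + b)\<close> would make \<open>2(a + b)\<close> divisible by
      4.\<close>
    then show "A = a + b"
      using A \<open>odd (a + b)\<close> by presburger
  qed
qed

end
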